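(* Let $p\ge 2$ and $n\ge 0$ be integers. The number of vertices of $\Gamma_n^{(p)}$ is $F_{n+p}^{(p)}$.
   Context: For an integer $n\ge 0$, the hypercube $Q_n$ has vertex set $\{0,1\}^n$ (binary strings of length $n$; for $n=0$ only the empty string), two strings being adjacent iff they differ in exactly one coordinate. For $p\ge2$, a $p$-th order Fibonacci string is a binary string that does not contain $1^p$ ($p$ consecutive 1s) as a substring (of consecutive letters). $\Gamma_n^{(p)}$ (the $p$-th order Fibonacci cube of dimension $n$) is the subgraph of $Q_n$ induced by the $p$-th order Fibonacci strings of length $n$; in particular $\Gamma_0^{(p)}=K_1$. The $p$-th order generalized Fibonacci numbers are defined by $F_n^{(p)}=0$ for $0\le n\le p-2$, $F_{p-1}^{(p)}=1$, and $F_n^{(p)}=F_{n-1}^{(p)}+F_{n-2}^{(p)}+\dots+F_{n-p}^{(p)}$ for $n\ge p$. *)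

theory Defs
  imports "Graph_Theory.Graph_Theory" "HOL-Library.Sublist"
begin

text \<open>
  Binary strings are boolean lists, with \<^const>\<open>True\<close> for the letter 1. Graphs are symmetric
  digraphs as in \<^locale>\<open>graph\<close>: an undirected edge is a pair of opposite arcs.
\<close>

definition hypercube :: "nat \<Rightarrow> (bool list, bool list \<times> bool list) pre_digraph" where
  "hypercube n = with_proj
     \<lparr> pverts = {w. length w = n},
       parcs = {(u, v). length u = n \<and> length v = n \<and> (\<exists>!i. i < n \<and> u ! i \<noteq> v ! i)} \<rparr>"

text \<open>\<^const>\<open>sublist\<close> is the relation of being a contiguous factor.\<close>

definition fibonacci_string :: "nat \<Rightarrow> bool list \<Rightarrow> bool" where
  "fibonacci_string p w \<longleftrightarrow> \<not> sublist (replicate p True) w"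

definition fibonacci_cube :: "nat \<Rightarrow> nat \<Rightarrow> (bool list, bool list \<times> bool list) pre_digraph" where
  "fibonacci_cube p n = hypercube n \<restriction> {w \<in> verts (hypercube n). fibonacci_string p w}"

fun gen_fib :: "nat \<Rightarrow> nat \<Rightarrow> nat" where
  "gen_fib p n =
     (if n + 2 \<le> p then 0 else if n + 1 = p then 1 else (\<Sum>k = 1..p. gen_fib p (n - k)))"

declare gen_fib.simps [simp del]

lemma gen_fib_eqs:
  assumes "p \<ge> 2"
  shows "n \<le> p - 2 \<Longrightarrow> gen_fib p n = 0"
    and "gen_fib p (p - 1) = 1"
    and "n \<ge> p \<Longrightarrow> gen_fib p n = (\<Sum>k = 1..p. gen_fib p (n - k))"
  using assms by (subst gen_fib.simps; simp)+

lemma finite_bool_lists: "finite {w :: bool list. length w = n}"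
  using finite_lists_length_eq [of "UNIV :: bool set" n] by simp

lemma graph_hypercube: "graph (hypercube n)"
proof -
  define A where "A = {(u :: bool list, v :: bool list).
    length u = n \<and> length v = n \<and> (\<exists>!i. i < n \<and> u ! i \<noteq> v ! i)}"
  define V where "V = {w :: bool list. length w = n}"
  have V: "finite V"
    unfolding V_def by (rule finite_bool_lists)
  have sub: "A \<subseteq> V \<times> V"
    unfolding A_def V_def by blast
  have A: "finite A"
    by (rule finite_subset [OF sub]) (simp add: V)
  have flip: "(\<lambda>i. i < n \<and> u ! i \<noteq> v ! i) = (\<lambda>i. i < n \<and> v ! i \<noteq> u ! i)"
    for u v :: "bool list"
    by blast
  have sym: "sym A"
    unfolding A_def
    by (rule symI) (simp only: mem_Collect_eq case_prod_conv, subst flip, blast)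
  have loop: "(u, u) \<notin> A" for u
    unfolding A_def by blast
  have "pair_graph \<lparr> pverts = V, parcs = A \<rparr>"
    using V A sym sub loop by unfold_locales (auto simp: symmetric_def)
  then show ?thesis
    unfolding hypercube_def A_def V_def by (rule pair_graph.pair_graphD_graph)
qed

lemma induced_subgraph_fibonacci_cube: "induced_subgraph (fibonacci_cube p n) (hypercube n)"
proof -
  interpret graph "hypercube n" by (rule graph_hypercube)
  show ?thesis
    unfolding fibonacci_cube_def by (rule induced_induce) auto
qed

lemma fibonacci_cube_0:
  assumes "p \<ge> 2"
  shows "verts (fibonacci_cube p 0) = {[]}" and "arcs (fibonacci_cube p 0) = {}"
  using assms by (auto simp: fibonacci_cube_def hypercube_def fibonacci_string_def)

end

theory Submission
  imports Defs
begin

text \<open>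
  A word avoiding \<open>1\<^sup>p\<close> begins with a maximal run of some \<open>j < p\<close> ones. Unless the run is the
  whole word, it is followed by a zero, and this zero shields the run from the rest: a factor
  \<open>1\<^sup>p\<close> cannot cross it, so after \<open>1\<^sup>j0\<close> any word avoiding \<open>1\<^sup>p\<close> may follow. Sorting the words of
  length \<open>n\<close> by \<open>j = k - 1\<close> thus gives one class in bijection with the words of length \<open>n - k\<close>
  for each \<open>k \<in> {1..p}\<close>, which is the recurrence of the generalized Fibonacci numbers
  (\<open>fibonacci_string_run_iff\<close>, \<open>fibonacci_strings_run_class\<close>).

  The recurrence can be used for every \<open>n\<close>, also below \<open>p\<close>, because the initial values of
  the numbers account exactly for the degenerate classes: the value 1 at index \<open>p - 1\<close> is the
  single word \<open>1\<^sup>n\<close> (\<open>k = n + 1\<close>), and the zeros before it are the empty classes of runs longer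
  than the word (\<open>k > n + 1\<close>). Hence one strong induction on \<open>n\<close> proves the theorem without a
  separate base case.
\<close>

definition fibonacci_strings :: "nat \<Rightarrow> nat \<Rightarrow> bool list set" where
  "fibonacci_strings p n = {w. length w = n \<and> fibonacci_string p w}"

abbreviation leading_ones :: "bool list \<Rightarrow> nat" where
  "leading_ones w \<equiv> length (takeWhile id w)"

lemma verts_fibonacci_cube: "verts (fibonacci_cube p n) = fibonacci_strings p n"
  by (auto simp: fibonacci_cube_def hypercube_def fibonacci_strings_def)

lemma finite_fibonacci_strings: "finite (fibonacci_strings p n)"
  by (rule finite_subset [OF _ finite_bool_lists [of n]]) (auto simp: fibonacci_strings_def)

lemma takeWhile_id_eq_replicate: "takeWhile id w = replicate (leading_ones w) True"
  by (induction w) auto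

lemma leading_ones_run: "leading_ones (replicate j True @ False # v) = j"
  by (induction j) auto

lemma run_decomposition:
  obtains "w = replicate (leading_ones w) True"
  | v where "w = replicate (leading_ones w) True @ False # v"
proof (cases "dropWhile id w")
  case Nil
  then have "takeWhile id w = w"
    by simp
  then show ?thesis
    by (metis that(1) takeWhile_id_eq_replicate)
next
  case (Cons a v)
  then have "\<not> a"
    using hd_dropWhile [of id w] by auto
  then have "w = replicate (leading_ones w) True @ False # v"
    using Cons takeWhile_id_eq_replicate [of w] takeWhile_dropWhile_id [of id w] by simp
  then show ?thesis
    by (rule that(2))
qed

text \<open>
  An occurrence of a factor without the letter \<open>a\<close> cannot cover the displayed \<open>a\<close>, so it lies
  entirely on one side of it. With \<open>a\<close> the letter 0, this is how a zero shields a run of ones.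
\<close>

lemma sublist_append_Cons_iff:
  assumes "a \<notin> set x"
  shows "sublist x (u @ a # v) \<longleftrightarrow> sublist x u \<or> sublist x v"
proof
  assume "sublist x (u @ a # v)"
  then consider "sublist x u" | "sublist x (a # v)"
    | x1 x2 where "x = x1 @ x2" "suffix x1 u" "prefix x2 (a # v)"
    by (auto simp: sublist_append)
  then show "sublist x u \<or> sublist x v"
  proof cases
    case 2
    then show ?thesis
      using assms by (auto simp: sublist_Cons_right prefix_Cons)
  next
    case 3
    then have "x2 = []"
      using assms by (auto simp: prefix_Cons)
    then show ?thesis
      using 3 by simp
  qed simp
next
  assume "sublist x u \<or> sublist x v"
  then show "sublist x (u @ a # v)"
    by (auto simp: sublist_append sublist_Cons_right)
qed

lemma fibonacci_string_run_iff:
  assumes "j < p"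
  shows "fibonacci_string p (replicate j True @ False # v) \<longleftrightarrow> fibonacci_string p v"
proof -
  have "\<not> sublist (replicate p True) (replicate j True)"
    using assms by (auto dest: sublist_length_le)
  then show ?thesis
    by (simp add: fibonacci_string_def sublist_append_Cons_iff)
qed

lemma leading_ones_less:
  assumes "fibonacci_string p w"
  shows "leading_ones w < p"
proof (rule ccontr)
  assume "\<not> leading_ones w < p"
  then have "prefix (replicate p True) (replicate (leading_ones w) True)"
    by (metis le_add_diff_inverse not_less prefixI replicate_add)
  then have "prefix (replicate p True) w"
    by (metis takeWhile_id_eq_replicate takeWhile_is_prefix prefix_order.trans)
  then show False
    using assms by (simp add: fibonacci_string_def)
qed

lemma fibonacci_strings_run_class:
  assumes "j < n" "j < p"
  shows "{w \<in> fibonacci_strings p n. leading_ones w = j} =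
    (\<lambda>v. replicate j True @ False # v) ` fibonacci_strings p (n - Suc j)" (is "?C = ?I")
proof
  show "?C \<subseteq> ?I"
  proof
    fix w assume "w \<in> ?C"
    then have w: "length w = n" "fibonacci_string p w" "leading_ones w = j"
      by (auto simp: fibonacci_strings_def)
    show "w \<in> ?I"
    proof (cases w rule: run_decomposition)
      case 1
      then have "length w = j"
        using w by (metis length_replicate)
      then show ?thesis
        using w assms by simp
    next
      case (2 v)
      then have eq: "w = replicate j True @ False # v"
        using w by simp
      then have "v \<in> fibonacci_strings p (n - Suc j)"
        using w assms by (auto simp: fibonacci_strings_def fibonacci_string_run_iff)
      then show ?thesis
        using eq by blast
    qed
  qed
  show "?I \<subseteq> ?C"
    using assms by (auto simp: fibonacci_strings_def fibonacci_string_run_iff leading_ones_run)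
qed

lemma fibonacci_strings_all_ones:
  assumes "n < p"
  shows "{w \<in> fibonacci_strings p n. leading_ones w = n} = {replicate n True}"
proof -
  have "w = replicate n True" if "length w = n" "leading_ones w = n" for w
    using that by (cases w rule: run_decomposition) (auto dest: arg_cong [of _ _ length])
  moreover have "leading_ones (replicate n True) = n"
    by (induction n) auto
  moreover have "fibonacci_string p (replicate n True)"
    using assms by (auto simp: fibonacci_string_def dest: sublist_length_le)
  ultimately show ?thesis
    by (auto simp: fibonacci_strings_def)
qed

lemma card_fibonacci_strings:
  assumes "p \<ge> 2"
  shows "card (fibonacci_strings p n) = gen_fib p (n + p)"
proof (induction n rule: less_induct)
  case (less n)
  define C where "C k = {w \<in> fibonacci_strings p n. leading_ones w = k - 1}" for k
  have card_C: "card (C k) = gen_fib p (n + p - k)" if k: "k \<in> {1..p}" for k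
  proof -
    consider "k \<le> n" | "k = n + 1" | "k > n + 1"
      by linarith
    then show ?thesis
    proof cases
      case 1
      have "k - 1 < n" "k - 1 < p" "Suc (k - 1) = k"
        using 1 k by auto
      then have "C k = (\<lambda>v. replicate (k - 1) True @ False # v) ` fibonacci_strings p (n - k)"
        unfolding C_def using fibonacci_strings_run_class [of "k - 1" n p] by simp
      then have "card (C k) = card (fibonacci_strings p (n - k))"
        by (simp add: card_image inj_on_def)
      also have "\<dots> = gen_fib p (n - k + p)"
        using less 1 k by simp
      finally show ?thesis
        using 1 by simp
    next
      case 2
      then show ?thesis
        using k fibonacci_strings_all_ones [of n p] gen_fib_eqs(2) [OF assms]
        by (simp add: C_def)
    next
      case 3
      have "leading_ones w \<noteq> k - 1" if "length w = n" for w
        using length_takeWhile_le [of id w] 3 that by linarith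
      then have "C k = {}"
        by (auto simp: C_def fibonacci_strings_def)
      moreover have "gen_fib p (n + p - k) = 0"
        using 3 k by (intro gen_fib_eqs(1) [OF assms]) simp
      ultimately show ?thesis
        by simp
    qed
  qed
  have "w \<in> (\<Union>k\<in>{1..p}. C k)" if "w \<in> fibonacci_strings p n" for w
    using that leading_ones_less [of p w]
    by (intro UN_I [of "leading_ones w + 1"]) (auto simp: C_def fibonacci_strings_def)
  then have "fibonacci_strings p n = (\<Union>k\<in>{1..p}. C k)"
    by (auto simp: C_def)
  then have "card (fibonacci_strings p n) = (\<Sum>k = 1..p. card (C k))"
    by (simp only:) (rule card_UN_disjoint; auto simp: C_def finite_fibonacci_strings)
  also have "\<dots> = (\<Sum>k = 1..p. gen_fib p (n + p - k))"
    by (intro sum.cong refl card_C)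
  also have "\<dots> = gen_fib p (n + p)"
    using gen_fib_eqs(3) [OF assms, of "n + p"] by simp
  finally show ?case .
qed

theorem proposition4p1:
  fixes p n :: nat
  assumes "p \<ge> 2"
  shows "card (verts (fibonacci_cube p n)) = gen_fib p (n + p)"
  using card_fibonacci_strings [OF assms] by (simp add: verts_fibonacci_cube)

end
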